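(* Let $\sigma=\sigma_{(\cdot,\triangleleft)}:X\times X\to X\times X$ be a birack on a set $X$, determined by the operations $\cdot$ and $\triangleleft$, and let $k:X\to X$ be an automorphism of $\sigma$, i.e. a bijection with $(k\times k)\sigma=\sigma(k\times k)$. Define $\sigma_k:=(k^{-1}\times\mathrm{Id})\circ\sigma\circ(k\times\mathrm{Id})$ and $x\cdot_k y:=k(x\cdot y)$. Then $$(\sigma_{(\cdot,\triangleleft)})_k=(k^{-1}\times\mathrm{Id})\circ\sigma_{(\cdot,\triangleleft)}\circ(k\times\mathrm{Id})=\sigma_{(\cdot_k,\triangleleft)}.$$
   Context: A birack on $X$ is a bijective map $\sigma:X\times X\to X\times X$, $\sigma(x,y)=(g_x(y),f_y(x))$, satisfying the braid equation $(\sigma\times \mathrm{Id})(\mathrm{Id}\times\sigma)(\sigma\times \mathrm{Id})=(\mathrm{Id}\times\sigma)(\sigma\times \mathrm{Id})(\mathrm{Id}\times\sigma)$, such that all $g_x$ and all $f_y$ are bijections of $X$. Its associated operations are: $x*y:=g_x(y)$; $x\cdot(-)$, the inverse of the bijection $x*(-)$; and $x\triangleleft y:=g_y(f_{g_x^{-1}(y)}(x))$. For any binary operations $\cdot,\triangleleft$ on $X$ with every $x\cdot(-)$ bijective, with inverse denoted $x*(-)$, the map $\sigma_{(\cdot,\triangleleft)}$ is defined by $\sigma_{(\cdot,\triangleleft)}(x,y):=\big(x*y,\ (x*y)\cdot(x\triangleleft(x*y))\big)$. A birack equals $\sigma_{(\cdot,\triangleleft)}$ for its associated operations. For the operation $\cdot_k$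 the inverse of $x\cdot_k(-)$ is $x*_k y=x*k^{-1}(y)$. *)

theory Defs
  imports Main
begin

definition left_act :: "('a \<times> 'a \<Rightarrow> 'a \<times> 'a) \<Rightarrow> 'a \<Rightarrow> 'a \<Rightarrow> 'a" where
  "left_act \<sigma> x y = fst (\<sigma> (x, y))"

definition right_act :: "('a \<times> 'a \<Rightarrow> 'a \<times> 'a) \<Rightarrow> 'a \<Rightarrow> 'a \<Rightarrow> 'a" where
  "right_act \<sigma> y x = snd (\<sigma> (x, y))"

text \<open>The triple product is right-nested, so \<open>\<sigma> \<times> Id\<close> has to be written with explicit
  reassociation, while \<open>Id \<times> \<sigma>\<close> is just \<open>map_prod id \<sigma>\<close>.\<close>

definition on_first_two :: "('a \<times> 'a \<Rightarrow> 'a \<times> 'a) \<Rightarrow> 'a \<times> 'a \<times> 'a \<Rightarrow> 'a \<times> 'a \<times> 'a" where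
  "on_first_two \<sigma> = (\<lambda>(x, y, z). (fst (\<sigma> (x, y)), snd (\<sigma> (x, y)), z))"

definition on_last_two :: "('a \<times> 'a \<Rightarrow> 'a \<times> 'a) \<Rightarrow> 'a \<times> 'a \<times> 'a \<Rightarrow> 'a \<times> 'a \<times> 'a" where
  "on_last_two \<sigma> = map_prod id \<sigma>"

definition braid_equation :: "('a \<times> 'a \<Rightarrow> 'a \<times> 'a) \<Rightarrow> bool" where
  "braid_equation \<sigma> \<longleftrightarrow>
     on_first_two \<sigma> \<circ> on_last_two \<sigma> \<circ> on_first_two \<sigma>
       = on_last_two \<sigma> \<circ> on_first_two \<sigma> \<circ> on_last_two \<sigma>"

definition birack :: "('a \<times> 'a \<Rightarrow> 'a \<times> 'a) \<Rightarrow> bool" where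
  "birack \<sigma> \<longleftrightarrow> bij \<sigma> \<and> braid_equation \<sigma>
     \<and> (\<forall>x. bij (left_act \<sigma> x)) \<and> (\<forall>y. bij (right_act \<sigma> y))"

definition birack_automorphism :: "('a \<times> 'a \<Rightarrow> 'a \<times> 'a) \<Rightarrow> ('a \<Rightarrow> 'a) \<Rightarrow> bool" where
  "birack_automorphism \<sigma> k \<longleftrightarrow> bij k \<and> map_prod k k \<circ> \<sigma> = \<sigma> \<circ> map_prod k k"

text \<open>In \<open>left_inv dot\<close>, \<open>birack_of dot tri\<close> and below, \<open>dot\<close> and \<open>tri\<close> stand for the operations
  \<open>\<cdot>\<close> and \<open>\<triangleleft>\<close>; \<open>left_inv dot\<close> is the operation \<open>*\<close>. It is meaningful only if every \<open>dot x\<close>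
  is bijective.\<close>

definition left_inv :: "('a \<Rightarrow> 'a \<Rightarrow> 'a) \<Rightarrow> 'a \<Rightarrow> 'a \<Rightarrow> 'a" where
  "left_inv dot x = inv (dot x)"

definition birack_of :: "('a \<Rightarrow> 'a \<Rightarrow> 'a) \<Rightarrow> ('a \<Rightarrow> 'a \<Rightarrow> 'a) \<Rightarrow> 'a \<times> 'a \<Rightarrow> 'a \<times> 'a" where
  "birack_of dot tri =
     (\<lambda>(x, y). (left_inv dot x y, dot (left_inv dot x y) (tri x (left_inv dot x y))))"

definition twist :: "('a \<Rightarrow> 'a) \<Rightarrow> ('a \<times> 'a \<Rightarrow> 'a \<times> 'a) \<Rightarrow> 'a \<times> 'a \<Rightarrow> 'a \<times> 'a" where
  "twist k \<sigma> = map_prod (inv k) id \<circ> \<sigma> \<circ> map_prod k id"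

definition twist_op :: "('a \<Rightarrow> 'a) \<Rightarrow> ('a \<Rightarrow> 'a \<Rightarrow> 'a) \<Rightarrow> 'a \<Rightarrow> 'a \<Rightarrow> 'a" where
  "twist_op k dot x y = k (dot x y)"

text \<open>Twisting by a bijection preserves bijectivity of the left multiplications, so
  \<open>birack_of (twist_op k dot) tri\<close> is meaningful whenever \<open>birack_of dot tri\<close> is.\<close>

lemma bij_twist_op: "bij k \<Longrightarrow> bij (dot x) \<Longrightarrow> bij (twist_op k dot x)"
  using bij_comp[of "dot x" k] by (simp add: twist_op_def[abs_def] comp_def)

lemma left_inv_twist_op:
  assumes "bij k" and "bij (dot x)"
  shows "left_inv (twist_op k dot) x y = left_inv dot x (inv k y)"
proof -
  have "twist_op k dot x = k \<circ> dot x"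
    by (auto simp: twist_op_def)
  then show ?thesis
    using o_inv_distrib[OF assms] by (simp add: left_inv_def)
qed

end

(* As k commutes with \<sigma> and y = k (k^-1 y), we have
   \<sigma> (k x, y) = (k \<times> k) (\<sigma> (x, k^-1 y)), so twisting by k is the same as
   (Id \<times> k) \<circ> \<sigma> \<circ> (Id \<times> k^-1); this is what replacing \<cdot> by \<cdot>_k does to
   \<sigma>, whether or not k is an automorphism. *)
theory Submission
  imports Defs
begin

lemma twist_eq_of_birack_automorphism:
  assumes "birack_automorphism \<sigma> k"
  shows "twist k \<sigma> = map_prod id k \<circ> \<sigma> \<circ> map_prod id (inv k)"
proof
  fix p :: "'a \<times> 'a"
  obtain x y where p: "p = (x, y)"
    by fastforce
  have k: "bij k" and comm: "map_prod k k \<circ> \<sigma> = \<sigma> \<circ> map_prod k k"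
    using assms by (simp_all add: birack_automorphism_def)
  have "\<sigma> (k x, y) = \<sigma> (map_prod k k (x, inv k y))"
    using k by (simp add: bij_is_surj surj_f_inv_f)
  also have "\<dots> = map_prod k k (\<sigma> (x, inv k y))"
    using fun_cong[OF comm, of "(x, inv k y)"] by simp
  \<comment> \<open>The outer \<open>inv k\<close> of \<open>twist\<close> cancels the
    \<open>k\<close> on the first component, so only the \<open>k\<close> on the second
    survives.\<close>
  finally show "twist k \<sigma> p = (map_prod id k \<circ> \<sigma> \<circ> map_prod id (inv k)) p"
    using k by (simp add: p twist_def map_prod_def split_beta bij_is_inj)
qed

text \<open>With u = \<open>left_inv dot x (inv k y)\<close>, both sides send (x, y) to (u, k
  (\<open>dot u (tri x u)\<close>)): inverting k after \<open>dot x\<close> puts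
  \<open>inv k\<close> on y, and the outer product in the second component contributes the
  k.\<close>

lemma birack_of_twist_op:
  assumes "bij k" and "\<And>x. bij (dot x)"
  shows "birack_of (twist_op k dot) tri
    = map_prod id k \<circ> birack_of dot tri \<circ> map_prod id (inv k)"
  using assms by (auto simp: fun_eq_iff birack_of_def left_inv_twist_op twist_op_def)

theorem lemma3p4:
  fixes \<sigma> :: "'a \<times> 'a \<Rightarrow> 'a \<times> 'a"
    and dot tri :: "'a \<Rightarrow> 'a \<Rightarrow> 'a"
    and k :: "'a \<Rightarrow> 'a"
  assumes "\<And>x. bij (dot x)"
    and "\<sigma> = birack_of dot tri"
    and "birack \<sigma>"
    and "birack_automorphism \<sigma> k"
  shows "twist k (birack_of dot tri) = map_prod (inv k) id \<circ> birack_of dot tri \<circ> map_prod k id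
       \<and> map_prod (inv k) id \<circ> birack_of dot tri \<circ> map_prod k id = birack_of (twist_op k dot) tri"
proof -
  have "bij k"
    using assms(4) by (simp add: birack_automorphism_def)
  \<comment> \<open>The first conjunct unfolds \<open>twist\<close>; in the second, both sides equal
    the same map by the two lemmas.\<close>
  then show ?thesis
    using twist_eq_of_birack_automorphism[OF assms(4)] assms(1,2)
    by (simp add: twist_def birack_of_twist_op)
qed

end
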